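(* For $P\in(0,1)$ and a positive integer $N$, let $\epsilon(\delta_N)>0$ be the solution $\epsilon$ of $K(\epsilon\sqrt N)=P$, where $K(z)=\sum_{j=-\infty}^{+\infty}(-1)^j\mathrm{e}^{-2j^2z^2}$ for $z>0$; let $\epsilon(\delta_N^-)>0$ be the solution $\epsilon$ of $1-\mathrm{e}^{-2N\epsilon^2}=P$; and let $\gamma(\delta_N^-)>0$ be the solution $\gamma$ of $$1-\exp(-2N\gamma^2)-\sqrt{\pi N}\,\gamma\exp(-N\gamma^2)\left[2\Phi\left(\sqrt{2N}\,\gamma\right)-1\right]=P,$$ where $\Phi(x)=\frac1{\sqrt{2\pi}}\int_{-\infty}^x\mathrm{e}^{-y^2/2}\,\mathrm{d}y$. Then for every $P\in(0,1)$ and every $N$, $$\epsilon(\delta_N^-)\le\epsilon(\delta_N),$$ and there exists $P_0\in(0,1)$ such that for all $P\in[P_0,1)$ and every $N$, $$\gamma(\delta_N^-)\le 2\epsilon(\delta_N^-)\le 2\epsilon(\delta_N).$$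
   Context: $K$ is Kolmogorov's distribution function, the limiting distribution function of $\sqrt N\sup_{x}|B(x)-B_{\mathrm{emp}}(x,N)|$, where $B_{\mathrm{emp}}(x,N)$ is the empirical distribution function of $N$ independent observations from $B$. The function $F(z)=1-\mathrm{e}^{-2z^2}$, $z\ge0$, is the limiting distribution function of the one-sided statistic $\sqrt N\sup_x[B(x)-B_{\mathrm{emp}}(x,N)]$. The left-hand side of the equation for $\gamma$ is $(F*F)(\gamma\sqrt N)$, where $F*F$ is the convolution of the distribution $F$ with itself. *)

theory Defs
  imports "HOL-Analysis.Analysis"
begin

(* The series converges absolutely for z > 0, the only arguments at which K is used;
   for z = 0 it is not summable and infsum returns a default value. *)
definition kolmogorov_K :: "real \<Rightarrow> real" where
  "kolmogorov_K z = (\<Sum>\<^sub>\<infinity>j::int. (-1) powi j * exp (- 2 * (of_int j)\<^sup>2 * z\<^sup>2))"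

definition Phi :: "real \<Rightarrow> real" where
  "Phi x = 1 / sqrt (2 * pi) * (LBINT y:{..x}. exp (- (y\<^sup>2) / 2))"

definition solves_eps :: "nat \<Rightarrow> real \<Rightarrow> real \<Rightarrow> bool" where
  "solves_eps N P e \<longleftrightarrow> e > 0 \<and> kolmogorov_K (e * sqrt (real N)) = P"

definition solves_eps_minus :: "nat \<Rightarrow> real \<Rightarrow> real \<Rightarrow> bool" where
  "solves_eps_minus N P e \<longleftrightarrow> e > 0 \<and> 1 - exp (- 2 * real N * e\<^sup>2) = P"

definition solves_gamma_minus :: "nat \<Rightarrow> real \<Rightarrow> real \<Rightarrow> bool" where
  "solves_gamma_minus N P g \<longleftrightarrow> g > 0 \<and>
     1 - exp (- 2 * real N * g\<^sup>2)
       - sqrt (pi * real N) * g * exp (- real N * g\<^sup>2) * (2 * Phi (sqrt (2 * real N) * g) - 1) = P"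

(* THE is meaningful only where the solution exists and is unique; for 0 < P < 1 and N > 0 this
   is part of what the theorem asserts. *)
definition eps :: "nat \<Rightarrow> real \<Rightarrow> real" where
  "eps N P = (THE e. solves_eps N P e)"

definition eps_minus :: "nat \<Rightarrow> real \<Rightarrow> real" where
  "eps_minus N P = (THE e. solves_eps_minus N P e)"

definition gamma_minus :: "nat \<Rightarrow> real \<Rightarrow> real" where
  "gamma_minus N P = (THE g. solves_gamma_minus N P g)"

end

(* With x = exp (- 2 z^2) one has K z = theta x, where theta x = 1 + 2 (sum over s >= 1 of
   (-1)^s x^(s^2)).  By an identity of Gauss, theta x is the product of the factors
   (1 - x^k) / (1 + x^k), each of which is decreasing in x; hence theta is decreasing wherever it
   is positive, and theta x <= 1 - x, i.e. K z <= 1 - exp (- 2 z^2).  This gives the uniqueness of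
   eps and eps_minus <= eps.

   With t = sqrt (2 N) g, the left-hand side of the equation for gamma is
   H t = 1 - exp (- t^2) - t exp (- t^2 / 2) I t, where I t is the integral of exp (- y^2 / 2)
   over [0, t].  Its derivative is exp (- t^2 / 2) B t with B 0 = 0 and B' t = 2 t I t > 0, so H is
   strictly increasing.  The bound I t <= t yields H (2 t) >= 1 - exp (- t^2) as soon as t^2 >= 6,
   whence P0 = 1 - exp (- 6). *)

theory Submission
  imports Defs "HOL-Probability.Distributions"
begin

section \<open>Gauss's product for the theta series\<close>

definition gauss_prod :: "nat \<Rightarrow> real \<Rightarrow> real" where
  "gauss_prod n x = (\<Prod>k=1..n. (1 - x ^ k) / (1 + x ^ k))"

definition theta_partial :: "nat \<Rightarrow> real \<Rightarrow> real" where
  "theta_partial n x = 1 + 2 * (\<Sum>s=1..n. (-1) ^ s * x ^ (s\<^sup>2))"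

text \<open>Jacobi's theta_4 at argument 0, with nome x. The index is \<open>Suc s\<close> because
  the constant term stands apart from the series.\<close>

definition theta :: "real \<Rightarrow> real" where
  "theta x = 1 + 2 * (\<Sum>s. (-1) ^ Suc s * x ^ ((Suc s)\<^sup>2))"

lemma gauss_prod_0 [simp]: "gauss_prod 0 x = 1"
  by (simp add: gauss_prod_def)

lemma gauss_prod_Suc: "gauss_prod (Suc n) x = gauss_prod n x * ((1 - x ^ Suc n) / (1 + x ^ Suc n))"
  by (simp add: gauss_prod_def)

lemma gauss_prod_pos:
  assumes "0 < x" "x < 1"
  shows "0 < gauss_prod n x"
proof -
  have "x ^ k < 1" if "k \<in> {1..n}" for k
    using that assms by (simp add: power_less_one_iff)
  then show ?thesis
    unfolding gauss_prod_def using assms by (intro prod_pos) (auto intro!: divide_pos_pos add_pos_pos)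
qed

lemma gauss_factor_le_one:
  assumes "0 < (x::real)"
  shows "(1 - x ^ k) / (1 + x ^ k) \<le> 1"
proof -
  have "0 < x ^ k" using assms by simp
  then show ?thesis by (simp add: field_simps)
qed

lemma gauss_prod_antimono:
  assumes "0 < x" "x < 1" "m \<le> n"
  shows "gauss_prod n x \<le> gauss_prod m x"
  using \<open>m \<le> n\<close>
proof (induction rule: dec_induct)
  case (step k)
  have "gauss_prod (Suc k) x \<le> gauss_prod k x * 1"
    unfolding gauss_prod_Suc
    by (rule mult_left_mono[OF gauss_factor_le_one]) (use assms gauss_prod_pos less_imp_le in auto)
  with step show ?case by simp
qed simp

text \<open>A finite form, in the style of D. Shanks, of Gauss's identity
  \<open>theta x = (\<Prod>k\<ge>1. (1 - x ^ k) / (1 + x ^ k))\<close>.\<close>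

lemma theta_partial_eq_gauss_prod_plus:
  assumes "0 < x" "x < 1"
  shows "theta_partial n x = gauss_prod n x
           + 2 * (\<Sum>s=1..n. (-1) ^ s * (gauss_prod n x / gauss_prod s x * x ^ (s * Suc n) / (1 + x ^ s)))"
proof (induction n)
  case 0
  then show ?case by (simp add: theta_partial_def)
next
  case (Suc n)
  let ?P = "\<lambda>n. gauss_prod n x"
  let ?y = "x ^ Suc n"
  define T where "T m s = (-1) ^ s * (?P m / ?P s * x ^ (s * Suc m) / (1 + x ^ s))" for m s
  define U where "U s = (-1) ^ s * (?P n / ?P s * x ^ (Suc s * Suc n))" for s
  have Ppos: "?P k > 0" for k by (rule gauss_prod_pos[OF assms])
  have xpos: "x ^ k > 0" for k using assms by simp
  have ypos: "1 + ?y > 0" using xpos[of "Suc n"] by linarith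
  \<comment> \<open>Raising \<open>n\<close> changes every term of the correction sum by a telescoping difference.\<close>
  have diff: "T (Suc n) (Suc s) - T n (Suc s) = (U s - U (Suc s)) / (1 + ?y)" for s
  proof -
    define a where "a = x ^ Suc s"
    define b where "b = x ^ Suc n"
    define c where "c = x ^ (Suc s * Suc n)"
    have ab: "a > 0" "b > 0" "c > 0" "a < 1"
      using assms by (simp_all add: a_def b_def c_def power_less_one_iff del: power_Suc)
    have PS: "?P (Suc s) = ?P s * ((1 - a) / (1 + a))" "?P (Suc n) = ?P n * ((1 - b) / (1 + b))"
      by (simp_all add: gauss_prod_Suc a_def b_def)
    have e: "x ^ (Suc s * Suc (Suc n)) = c * a" "x ^ (Suc (Suc s) * Suc n) = c * b"
      by (simp_all add: a_def b_def c_def power_add[symmetric] algebra_simps)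
    have nz: "?P s \<noteq> 0" "1 - a \<noteq> 0" "1 + a \<noteq> 0" "1 + b \<noteq> 0"
      using Ppos[of s] ab by auto
    define p where "p = ?P s"
    define q where "q = ?P n"
    \<comment> \<open>With \<open>p\<close> and \<open>q\<close> for the products, the claim is an
      identity of rational functions in \<open>a\<close>, \<open>b\<close>, \<open>c\<close>,
      \<open>p\<close>, \<open>q\<close>; the alternating sign is multiplied in afterwards.\<close>
    have "q * ((1 - b) / (1 + b)) / (p * ((1 - a) / (1 + a))) * (c * a) / (1 + a)
            - q / (p * ((1 - a) / (1 + a))) * c / (1 + a)
        = - (q / p * c + q / (p * ((1 - a) / (1 + a))) * (c * b)) / (1 + b)"
      using nz unfolding p_def[symmetric]
      by (simp add: divide_simps) (simp add: algebra_simps)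
    then have "- ((-1) ^ s) * (q * ((1 - b) / (1 + b)) / (p * ((1 - a) / (1 + a))) * (c * a) / (1 + a)
            - q / (p * ((1 - a) / (1 + a))) * c / (1 + a))
        = - ((-1) ^ s) * (- (q / p * c + q / (p * ((1 - a) / (1 + a))) * (c * b)) / (1 + b))"
      by (rule arg_cong)
    then show ?thesis
      unfolding T_def U_def e PS a_def[symmetric] b_def[symmetric] c_def[symmetric]
        p_def[symmetric] q_def[symmetric]
      by (simp add: algebra_simps diff_divide_distrib add_divide_distrib)
  qed
  have "(\<Sum>s=1..n. T (Suc n) s) - (\<Sum>s=1..n. T n s) = (\<Sum>s<n. T (Suc n) (Suc s) - T n (Suc s))"
    by (simp add: sum_subtractf sum.atLeast1_atMost_eq)
  also have "\<dots> = (\<Sum>s<n. U s - U (Suc s)) / (1 + ?y)"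
    by (simp add: diff sum_divide_distrib)
  also have "(\<Sum>s<n. U s - U (Suc s)) = U 0 - U n"
    by (rule sum_lessThan_telescope')
  finally have tele: "(\<Sum>s=1..n. T (Suc n) s) = (\<Sum>s=1..n. T n s) + (U 0 - U n) / (1 + ?y)"
    by simp
  define b where "b = ?y"
  define d where "d = x ^ (Suc n * Suc n)"
  have U0: "U 0 = ?P n * b" by (simp add: U_def b_def)
  have Un: "U n = (-1) ^ n * d" using Ppos[of n] by (simp add: U_def d_def)
  have Tn: "T (Suc n) (Suc n) = - ((-1) ^ n) * (d * b / (1 + b))"
    using Ppos[of "Suc n"] by (simp add: T_def d_def b_def power_add[symmetric] algebra_simps)
  have Pn: "?P (Suc n) = ?P n * ((1 - b) / (1 + b))" by (simp add: gauss_prod_Suc b_def)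
  have "1 + b \<noteq> 0" using ypos by (simp add: b_def)
  \<comment> \<open>\<open>U 0\<close> makes up for the new factor of the product, while
    \<open>U n\<close> and the new summand combine, by d / (1 + b) + d * b / (1 + b) = d, into the
    next theta term.\<close>
  then have "?P (Suc n) + 2 * ((U 0 - U n) / (1 + b) + T (Suc n) (Suc n)) = ?P n - 2 * ((-1) ^ n * d)"
    unfolding U0 Un Tn Pn by (simp add: divide_simps) (simp add: algebra_simps)
  moreover have "theta_partial (Suc n) x = theta_partial n x - 2 * ((-1) ^ n * d)"
    by (simp add: theta_partial_def d_def power2_eq_square)
  moreover have "theta_partial n x = ?P n + 2 * (\<Sum>s=1..n. T n s)"
    using Suc.IH by (simp add: T_def)
  ultimately have "theta_partial (Suc n) x = ?P (Suc n) + 2 * (\<Sum>s=1..Suc n. T (Suc n) s)"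
    using tele by (simp add: b_def)
  then show ?case by (simp add: T_def)
qed

text \<open>Each of the n correction terms is at most x^n in absolute value: the products decrease,
  so their quotient is at most 1, and the exponent \<open>s * Suc n\<close> is at least n.\<close>

lemma theta_partial_minus_gauss_prod_le:
  assumes "0 < x" "x < 1"
  shows "\<bar>theta_partial n x - gauss_prod n x\<bar> \<le> 2 * (real n * x ^ n)"
proof -
  let ?T = "\<lambda>s. (-1) ^ s * (gauss_prod n x / gauss_prod s x * x ^ (s * Suc n) / (1 + x ^ s))"
  have "\<bar>?T s\<bar> \<le> x ^ n" if s: "s \<in> {1..n}" for s
  proof -
    have pos: "0 < gauss_prod n x" "0 < gauss_prod s x" "0 < x ^ s"
      using assms by (simp_all add: gauss_prod_pos)
    have "gauss_prod n x / gauss_prod s x \<le> 1"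
      using gauss_prod_antimono[OF assms, of s n] s pos by simp
    moreover have "x ^ (s * Suc n) \<le> x ^ n"
    proof (rule power_decreasing)
      have "1 * n \<le> s * Suc n" using s by (intro mult_le_mono) auto
      then show "n \<le> s * Suc n" by simp
    qed (use assms in auto)
    ultimately have "gauss_prod n x / gauss_prod s x * x ^ (s * Suc n) \<le> 1 * x ^ n"
      using pos assms by (intro mult_mono) auto
    moreover have "gauss_prod n x / gauss_prod s x * x ^ (s * Suc n) / (1 + x ^ s)
        \<le> gauss_prod n x / gauss_prod s x * x ^ (s * Suc n)"
      using pos assms by (intro mult_imp_div_pos_le) (auto simp: divide_simps intro!: add_pos_pos)
    ultimately show ?thesis using pos assms by (simp add: abs_mult)
  qed
  then have "\<bar>\<Sum>s=1..n. ?T s\<bar> \<le> real n * x ^ n"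
    by (intro order_trans[OF sum_abs] order_trans[OF sum_bounded_above[where K = "x ^ n"]]) auto
  then show ?thesis
    using theta_partial_eq_gauss_prod_plus[OF assms, of n] by simp
qed

section \<open>The theta function as a limit, and Kolmogorov's series\<close>

lemma theta_term_le:
  assumes "0 \<le> x" "x < 1"
  shows "norm ((-1) ^ Suc s * x ^ ((Suc s)\<^sup>2)) \<le> (x::real) ^ s"
proof -
  have "s \<le> (Suc s)\<^sup>2" by (simp add: power2_eq_square)
  then show ?thesis using assms by (simp add: abs_mult power_decreasing del: power_Suc)
qed

lemma theta_partial_tendsto_theta:
  assumes "0 \<le> x" "x < 1"
  shows "(\<lambda>n. theta_partial n x) \<longlonglongrightarrow> theta x"
proof -
  have "summable (\<lambda>s. (-1) ^ Suc s * x ^ ((Suc s)\<^sup>2))"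
    by (rule summable_comparison_test'[OF summable_geometric[of x]])
       (use assms theta_term_le in auto)
  then have "(\<lambda>n. \<Sum>s<n. (-1) ^ Suc s * x ^ ((Suc s)\<^sup>2)) \<longlonglongrightarrow> (\<Sum>s. (-1) ^ Suc s * x ^ ((Suc s)\<^sup>2))"
    by (rule summable_LIMSEQ)
  then show ?thesis
    unfolding theta_def theta_partial_def One_nat_def sum.atLeast1_atMost_eq
    by (intro tendsto_intros)
qed

text \<open>Gauss's identity in the limit, since n * x^n tends to 0. It lets \<open>theta\<close>
  inherit bounds and monotonicity from the finite products, which the alternating series does not
  show.\<close>

lemma gauss_prod_tendsto_theta:
  assumes "0 < x" "x < 1"
  shows "(\<lambda>n. gauss_prod n x) \<longlonglongrightarrow> theta x"
proof -
  have "(\<lambda>n. 2 * (real n * x ^ n)) \<longlonglongrightarrow> 2 * 0"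
    using assms by (intro tendsto_mult tendsto_const powser_times_n_limit_0) auto
  then have "(\<lambda>n. 2 * (real n * x ^ n)) \<longlonglongrightarrow> 0" by simp
  then have "(\<lambda>n. theta_partial n x - gauss_prod n x) \<longlonglongrightarrow> 0"
    by (rule Lim_null_comparison[rotated])
       (simp add: theta_partial_minus_gauss_prod_le[OF assms])
  from tendsto_diff[OF theta_partial_tendsto_theta[of x] this] show ?thesis using assms by simp
qed

lemma continuous_on_theta:
  assumes "r < 1"
  shows "continuous_on {0..r} theta"
proof -
  have "uniform_limit {0..r} (\<lambda>n x. \<Sum>s<n. (-1) ^ Suc s * x ^ ((Suc s)\<^sup>2))
          (\<lambda>x. \<Sum>s. (-1) ^ Suc s * x ^ ((Suc s)\<^sup>2)) sequentially"
  \<comment> \<open>For negative r the interval is empty.\<close>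
  proof (cases "0 \<le> r")
    case True
    then show ?thesis
    proof (intro Weierstrass_m_test[where M = "\<lambda>s. r ^ s"])
      fix s x assume "x \<in> {0..r}"
      then show "norm ((-1) ^ Suc s * x ^ ((Suc s)\<^sup>2)) \<le> r ^ s"
        using order_trans[OF theta_term_le[of x s] power_mono[of x r s]] assms by auto
    qed (use assms in auto)
  qed auto
  then have "continuous_on {0..r} (\<lambda>x::real. \<Sum>s. (-1) ^ Suc s * x ^ ((Suc s)\<^sup>2))"
    by (rule uniform_limit_theorem[rotated]) (simp, intro always_eventually allI continuous_intros)
  then show ?thesis unfolding theta_def by (intro continuous_intros)
qed

text \<open>From n = 1 on, every product is bounded by its first factor (1 - x) / (1 + x), which is
  at most 1 - x.\<close>

lemma theta_le:
  assumes "0 < x" "x < 1"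
  shows "theta x \<le> 1 - x"
proof (rule LIMSEQ_le_const2[OF gauss_prod_tendsto_theta[OF assms]])
  have "gauss_prod n x \<le> 1 - x" if "n \<ge> 1" for n
  proof -
    have "gauss_prod n x \<le> gauss_prod 1 x" by (rule gauss_prod_antimono[OF assms that])
    also have "\<dots> \<le> 1 - x"
      using assms gauss_prod_pos[of x 1]
      by (simp add: gauss_prod_def divide_le_eq mult_le_cancel_left1)
    finally show ?thesis .
  qed
  then show "\<exists>N. \<forall>n\<ge>N. gauss_prod n x \<le> 1 - x" by blast
qed

text \<open>Comparing factors gives only a weak inequality in the limit. Strictness comes from the
  first factor: the ratio c < 1 does not depend on n, so \<open>theta b \<le> c * theta a\<close>.
  Positivity of \<open>theta b\<close> rules out \<open>theta a = 0\<close>, and then c < 1 is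
  decisive.\<close>

lemma theta_strict_antimono:
  assumes "0 < a" "a < b" "b < 1" "0 < theta b"
  shows "theta b < theta a"
proof -
  have factor: "(1 - b ^ k) / (1 + b ^ k) \<le> (1 - a ^ k) / (1 + a ^ k)" for k
  proof -
    have "a ^ k \<le> b ^ k" "0 < a ^ k" "0 < b ^ k" using assms by (auto intro: power_mono)
    then show ?thesis by (simp add: field_simps)
  qed
  define c where "c = ((1 - b) / (1 + b)) / ((1 - a) / (1 + a))"
  have "(1 - b) / (1 + b) < (1 - a) / (1 + a)" using assms by (simp add: field_simps)
  moreover have "0 < (1 - a) / (1 + a)" using assms by simp
  ultimately have c: "c < 1" unfolding c_def by (subst divide_less_eq_1_pos)
  have "gauss_prod (Suc n) b \<le> c * gauss_prod (Suc n) a" for n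
  proof -
    have split: "gauss_prod (Suc n) x = (1 - x) / (1 + x) * (\<Prod>k=2..Suc n. (1 - x ^ k) / (1 + x ^ k))" for x
      unfolding gauss_prod_def by (subst prod.atLeast_Suc_atMost) (auto simp: numeral_2_eq_2)
    have "b ^ k \<le> 1" for k using assms by (simp add: power_le_one)
    then have "(\<Prod>k=2..Suc n. (1 - b ^ k) / (1 + b ^ k)) \<le> (\<Prod>k=2..Suc n. (1 - a ^ k) / (1 + a ^ k))"
      using assms by (intro prod_mono) (auto intro!: factor divide_nonneg_pos add_pos_pos)
    then have "gauss_prod (Suc n) b \<le> (1 - b) / (1 + b) * (\<Prod>k=2..Suc n. (1 - a ^ k) / (1 + a ^ k))"
      unfolding split using assms by (intro mult_left_mono) auto
    also have "\<dots> = c * gauss_prod (Suc n) a"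
      unfolding split c_def using assms by simp
    finally show ?thesis .
  qed
  moreover have "(\<lambda>n. gauss_prod (Suc n) b) \<longlonglongrightarrow> theta b" "(\<lambda>n. c * gauss_prod (Suc n) a) \<longlonglongrightarrow> c * theta a"
    using LIMSEQ_Suc[OF gauss_prod_tendsto_theta[of b]]
      tendsto_mult[OF tendsto_const LIMSEQ_Suc[OF gauss_prod_tendsto_theta[of a]]] assms by auto
  ultimately have le: "theta b \<le> c * theta a"
    by (intro LIMSEQ_le[of "\<lambda>n. gauss_prod (Suc n) b"]) auto
  have "0 \<le> theta a"
    using gauss_prod_pos[of a] gauss_prod_tendsto_theta[of a] assms
    by (intro LIMSEQ_le_const[of "\<lambda>n. gauss_prod n a"] exI[of _ 0]) (simp_all add: less_imp_le)
  with le \<open>0 < theta b\<close> have "0 < theta a" by (cases "theta a = 0") auto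
  then have "c * theta a < 1 * theta a" using c by (intro mult_strict_right_mono)
  with le show ?thesis by simp
qed

lemma theta_eq_ex1:
  assumes "0 < P" "P < 1"
  shows "\<exists>!x. 0 < x \<and> x < 1 \<and> theta x = P"
proof (rule ex_ex1I)
  have t0: "theta 0 = 1" by (simp add: theta_def power_0_left)
  \<comment> \<open>The right endpoint comes from \<open>theta_le\<close>, which at 1 - P gives
    exactly the bound P; at the left endpoint \<open>theta\<close> is 1 > P.\<close>
  have "\<exists>x. 0 \<le> x \<and> x \<le> 1 - P \<and> theta x = P"
  proof (rule IVT2')
    show "theta (1 - P) \<le> P" using theta_le[of "1 - P"] assms by simp
  qed (use assms t0 continuous_on_theta in auto)
  then obtain x where x: "0 \<le> x" "x \<le> 1 - P" "theta x = P" by blast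
  moreover have "x \<noteq> 0" using x t0 assms by auto
  ultimately show "\<exists>x. 0 < x \<and> x < 1 \<and> theta x = P" using assms by (intro exI[of _ x]) auto
next
  fix x y assume "0 < x \<and> x < 1 \<and> theta x = P" "0 < y \<and> y < 1 \<and> theta y = P"
  then show "x = y"
    using theta_strict_antimono[of x y] theta_strict_antimono[of y x] assms
    by (cases x y rule: linorder_cases) auto
qed

text \<open>\<open>infsum\<close> is a limit over all finite sets of integers. Once absolute
  summability is known, the limit can be taken along the symmetric intervals, whose sums are the
  \<open>theta_partial n x\<close>.\<close>

lemma kolmogorov_K_eq_theta:
  assumes "z \<noteq> 0"
  shows "kolmogorov_K z = theta (exp (- 2 * z\<^sup>2))"
proof -
  define x where "x = exp (- 2 * z\<^sup>2)"
  have x: "0 < x" "x < 1" using assms by (auto simp: x_def)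
  define f where "f j = (-1) powi j * exp (- 2 * (of_int j)\<^sup>2 * z\<^sup>2)" for j :: int
  have xpow: "x ^ (n\<^sup>2) = exp (- 2 * (real n)\<^sup>2 * z\<^sup>2)" for n
    unfolding x_def exp_of_nat_mult[symmetric] by (simp add: mult_ac)
  have f_nat: "f (int n) = (-1) ^ n * x ^ (n\<^sup>2)" "f (- int n) = (-1) ^ n * x ^ (n\<^sup>2)" for n
    unfolding xpow by (simp_all add: f_def power_int_minus flip: power_inverse)
  have symm: "(\<Sum>j=-int n..int n. g j) = g 0 + (\<Sum>s=1..n. g (int s) + g (- int s))"
    for g :: "int \<Rightarrow> real" and n
  proof (induction n)
    case (Suc n)
    have "{-int (Suc n)..int (Suc n)} = insert (int (Suc n)) (insert (- int (Suc n)) {-int n..int n})"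
      by auto
    with Suc show ?case by simp
  qed simp
  \<comment> \<open>Used twice: to bound the sums of absolute values, and to pass from finite sets
    to the sequence of intervals.\<close>
  have cofinal: "\<exists>n. F \<subseteq> {-int n..int n}" if fin: "finite F" for F :: "int set"
  proof -
    obtain n where n: "\<forall>m\<in>(\<lambda>j. nat \<bar>j\<bar>) ` F. m \<le> n"
      using finite_imageI[OF fin, of "\<lambda>j. nat \<bar>j\<bar>"] unfolding finite_nat_set_iff_bounded_le by blast
    have "-int n \<le> j \<and> j \<le> int n" if "j \<in> F" for j
      using n that by (auto simp: nat_le_iff abs_le_iff)
    then have "F \<subseteq> {-int n..int n}" by auto
    then show ?thesis ..
  qed
  have "f summable_on UNIV"
  proof (rule abs_summable_summable, rule nonneg_bdd_above_summable_on)
    show "bdd_above (sum (\<lambda>j. norm (f j)) ` {F. F \<subseteq> UNIV \<and> finite F})"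
    proof (rule bdd_aboveI2)
      fix F :: "int set" assume "F \<in> {F. F \<subseteq> UNIV \<and> finite F}"
      then obtain n where n: "F \<subseteq> {-int n..int n}" using cofinal by auto
      have "(\<Sum>j\<in>F. norm (f j)) \<le> (\<Sum>j=-int n..int n. norm (f j))"
        using n by (intro sum_mono2) auto
      also have "\<dots> = norm (f 0) + (\<Sum>s=1..n. norm (f (int s)) + norm (f (- int s)))"
        by (rule symm)
      also have "\<dots> = 1 + 2 * (\<Sum>s=1..n. x ^ (s\<^sup>2))"
        using f_nat[of 0] x by (simp add: f_nat abs_mult sum_distrib_left)
      also have "(\<Sum>s=1..n. x ^ (s\<^sup>2)) \<le> (\<Sum>s=1..n. x ^ s)"
        using x by (intro sum_mono power_decreasing) (auto simp: power2_eq_square)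
      also have "\<dots> \<le> (\<Sum>s. x ^ s)"
        using x by (intro sum_le_suminf) auto
      finally show "(\<Sum>j\<in>F. norm (f j)) \<le> 1 + 2 * (\<Sum>s. x ^ s)" by simp
    qed
  qed simp
  then have "(sum f \<longlongrightarrow> infsum f UNIV) (finite_subsets_at_top UNIV)"
    using has_sum_infsum has_sum_def by blast
  moreover have "filterlim (\<lambda>n. {-int n..int n}) (finite_subsets_at_top UNIV) sequentially"
    unfolding filterlim_finite_subsets_at_top
  proof (intro allI impI)
    fix X :: "int set" assume "finite X \<and> X \<subseteq> UNIV"
    then obtain n where "X \<subseteq> {-int n..int n}" using cofinal by auto
    then show "\<forall>\<^sub>F y in sequentially. finite {-int y..int y} \<and> X \<subseteq> {-int y..int y} \<and> {-int y..int y} \<subseteq> UNIV"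
      by (intro eventually_sequentiallyI[of n]) auto
  qed
  ultimately have "(\<lambda>n. \<Sum>j=-int n..int n. f j) \<longlonglongrightarrow> infsum f UNIV"
    by (rule filterlim_compose)
  moreover have "(\<Sum>j=-int n..int n. f j) = theta_partial n x" for n
    unfolding symm theta_partial_def using f_nat[of 0] by (simp add: f_nat sum_distrib_left)
  ultimately have "infsum f UNIV = theta x"
    using theta_partial_tendsto_theta[of x] x LIMSEQ_unique by auto
  then show ?thesis by (simp add: kolmogorov_K_def f_def[abs_def] x_def)
qed

section \<open>The convolution of the one-sided limit law\<close>

text \<open>For t >= 0 this is sqrt (pi / 2) * erf (t / sqrt 2).\<close>

definition gauss_int :: "real \<Rightarrow> real" where
  "gauss_int t = integral {0..t} (\<lambda>y. exp (- (y\<^sup>2) / 2))"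

text \<open>The function H of the overview: F * F at t / sqrt 2, where F z = 1 - exp (- 2 z^2). The
  scaling removes N.\<close>

definition conv_cdf :: "real \<Rightarrow> real" where
  "conv_cdf t = 1 - exp (- t\<^sup>2) - t * exp (- t\<^sup>2 / 2) * gauss_int t"

section \<open>The Gaussian integral and the normal distribution function\<close>

lemma gauss_integrable: "integrable lborel (\<lambda>y::real. exp (- (y\<^sup>2) / 2))"
  and gauss_integral: "(LBINT y. exp (- (y\<^sup>2) / 2)) = sqrt (2 * pi)"
proof -
  have eq: "exp (- (y\<^sup>2) / 2) = sqrt (2 * pi) * std_normal_density y" for y :: real
    by (simp add: std_normal_density_def)
  show "integrable lborel (\<lambda>y::real. exp (- (y\<^sup>2) / 2))"
    unfolding eq by (intro integrable_mult_right integrable_normal_density) simp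
  show "(LBINT y. exp (- (y\<^sup>2) / 2)) = sqrt (2 * pi)"
    unfolding eq by simp
qed

text \<open>By reflection the negative half-line carries half of the total mass sqrt (2 pi); doubled
  and normalised, this half cancels the 1.\<close>

lemma Phi_eq_gauss_int:
  assumes "0 \<le> t"
  shows "2 * Phi t - 1 = 2 / sqrt (2 * pi) * gauss_int t"
proof -
  let ?f = "\<lambda>y::real. exp (- (y\<^sup>2) / 2)"
  have int: "set_integrable lborel A ?f" if "A \<in> sets borel" for A
    unfolding set_integrable_def
    using integrable_mult_indicator[OF _ gauss_integrable, of A] that by simp
  have "sqrt (2 * pi) = (LBINT y:UNIV. ?f y)"
    using gauss_integral by (simp add: set_lebesgue_integral_def)
  also have "UNIV = {..0::real} \<union> {0<..}" by auto
  also have "(LBINT y:{..0} \<union> {0<..}. ?f y) = (LBINT y:{..0}. ?f y) + (LBINT y:{0<..}. ?f y)"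
    by (intro set_integral_Un int) auto
  also have "(LBINT y:{0<..}. ?f y) = (LBINT y:{..0}. ?f y)"
  proof -
    have "(LBINT y:{..0}. ?f y) = (LBINT y:{0..}. ?f y)"
      by (subst set_integral_reflect) (simp add: atLeast_def)
    also have "\<dots> = (LBINT y:{0<..}. ?f y)"
      unfolding set_lebesgue_integral_def
    proof (rule integral_cong_AE)
      show "AE y in lborel. indicator {0..} y *\<^sub>R ?f y = indicator {0<..} y *\<^sub>R ?f y"
        using AE_lborel_singleton[of "0::real"] by eventually_elim (auto simp: indicator_def)
    qed measurable
    finally show ?thesis ..
  qed
  finally have half: "(LBINT y:{..0}. ?f y) = sqrt (2 * pi) / 2" by simp
  have "{..t} = {..0} \<union> {0<..t}" using assms by auto
  then have "(LBINT y:{..t}. ?f y) = (LBINT y:{..0} \<union> {0<..t}. ?f y)" by simp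
  also have "\<dots> = (LBINT y:{..0}. ?f y) + (LBINT y:{0<..t}. ?f y)"
    by (intro set_integral_Un int) auto
  also have "(LBINT y:{0<..t}. ?f y) = gauss_int t"
  proof -
    have "(LBINT y:{0<..t}. ?f y) = integral {0<..t} ?f"
      by (intro set_borel_integral_eq_integral int) auto
    also have "\<dots> = gauss_int t"
      unfolding gauss_int_def
      by (rule integral_spike_set; rule negligible_subset[of "{0}"]) auto
    finally show ?thesis .
  qed
  finally show ?thesis unfolding Phi_def half
    by (simp add: field_simps)
qed

lemma gauss_int_has_derivative:
  assumes "0 < t"
  shows "(gauss_int has_real_derivative exp (- (t\<^sup>2) / 2)) (at t)"
proof -
  \<comment> \<open>The endpoint t + 1 makes t an interior point, so the derivative within the
    interval is the full one.\<close>
  have "(gauss_int has_real_derivative exp (- (t\<^sup>2) / 2)) (at t within {0..t+1})"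
    unfolding gauss_int_def using assms
    by (intro integral_has_real_derivative) (auto intro!: continuous_intros)
  then show ?thesis using assms at_within_Icc_at[of 0 t "t+1"] by simp
qed

lemma continuous_on_gauss_int: "continuous_on {0..b} gauss_int"
  unfolding gauss_int_def
  by (intro indefinite_integral_continuous_1 integrable_continuous_real continuous_intros) simp

lemma gauss_int_le:
  assumes "0 \<le> t"
  shows "gauss_int t \<le> t"
proof -
  have "gauss_int t \<le> integral {0..t} (\<lambda>_. 1)"
    unfolding gauss_int_def
    by (rule integral_le) (auto intro!: integrable_continuous_real continuous_intros)
  then show ?thesis using assms by simp
qed

lemma gauss_int_pos:
  assumes "0 < t"
  shows "0 < gauss_int t"
proof -
  have "gauss_int 0 < gauss_int t"
  proof (rule DERIV_pos_imp_increasing_open[OF assms])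
    fix u :: real assume "0 < u" "u < t"
    then show "\<exists>y. (gauss_int has_real_derivative y) (at u) \<and> 0 < y"
      using gauss_int_has_derivative[of u] exp_gt_zero by blast
  qed (rule continuous_on_gauss_int)
  then show ?thesis by (simp add: gauss_int_def)
qed

section \<open>Strict monotonicity and growth of the convolution\<close>

lemma gauss_has_derivative:
  "((\<lambda>t. exp (- t\<^sup>2 / 2)) has_real_derivative - t * exp (- t\<^sup>2 / 2)) (at t)"
  by (auto intro!: derivative_eq_intros)

text \<open>This is the cofactor of \<open>exp (- t\<^sup>2 / 2)\<close> in the derivative of
  \<open>conv_cdf\<close>. Its second summand is negative for t < 1, but in its own derivative the
  exponentials cancel and leave 2 * t * \<open>gauss_int t\<close>.\<close>

lemma conv_cdf_deriv_pos:
  assumes "0 < t"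
  shows "0 < t * exp (- t\<^sup>2 / 2) + (t\<^sup>2 - 1) * gauss_int t"
proof -
  let ?B = "\<lambda>t. t * exp (- t\<^sup>2 / 2) + (t\<^sup>2 - 1) * gauss_int t"
  have "?B 0 < ?B t"
  proof (rule DERIV_pos_imp_increasing_open[OF assms])
    fix u :: real assume u: "0 < u" "u < t"
    have "((\<lambda>t. t\<^sup>2 - 1) has_real_derivative 2 * u) (at u)" by (auto intro!: derivative_eq_intros)
    note DERIV_add[OF DERIV_mult[OF DERIV_ident gauss_has_derivative]
        DERIV_mult[OF this gauss_int_has_derivative[OF u(1)]]]
    then have "(?B has_real_derivative 2 * u * gauss_int u) (at u)"
      by (rule DERIV_cong) (simp add: algebra_simps power2_eq_square)
    then show "\<exists>y. (?B has_real_derivative y) (at u) \<and> 0 < y"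
      using u gauss_int_pos[of u] by (intro exI[of _ "2 * u * gauss_int u"]) auto
  qed (intro continuous_intros continuous_on_gauss_int, simp)
  then show ?thesis by (simp add: gauss_int_def)
qed

lemma continuous_on_conv_cdf: "continuous_on {0..b} conv_cdf"
  unfolding conv_cdf_def by (intro continuous_intros continuous_on_gauss_int) simp

text \<open>At a = 0 \<open>gauss_int\<close> has no two-sided derivative, so the criterion used
  asks for derivatives inside the interval and continuity up to its ends.\<close>

lemma conv_cdf_strict_mono:
  assumes "0 \<le> a" "a < b"
  shows "conv_cdf a < conv_cdf b"
proof (rule DERIV_pos_imp_increasing_open[OF \<open>a < b\<close>])
  fix t assume t: "a < t" "t < b"
  then have "0 < t" using assms by simp
  define u where "u = exp (- t\<^sup>2 / 2)"
  let ?B = "t * u + (t\<^sup>2 - 1) * gauss_int t"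
  \<comment> \<open>As a square of u, this term too lets u be factored out of the
    derivative.\<close>
  have "exp (- t\<^sup>2) = u * u" by (simp add: u_def flip: exp_add)
  then have "((\<lambda>t. 1 - exp (- t\<^sup>2)) has_real_derivative 2 * t * (u * u)) (at t)"
    by (auto intro!: derivative_eq_intros)
  note DERIV_diff[OF this DERIV_mult[OF DERIV_mult[OF DERIV_ident gauss_has_derivative]
        gauss_int_has_derivative[OF \<open>0 < t\<close>]], folded u_def]
  then have "(conv_cdf has_real_derivative u * ?B) (at t)"
    unfolding conv_cdf_def by (rule DERIV_cong) (simp add: algebra_simps power2_eq_square)
  then show "\<exists>y. (conv_cdf has_real_derivative y) (at t) \<and> 0 < y"
    using conv_cdf_deriv_pos[OF \<open>0 < t\<close>] by (intro exI[of _ "u * ?B"]) (simp add: u_def)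
qed (use assms in \<open>auto intro: continuous_on_subset[OF continuous_on_conv_cdf]\<close>)

text \<open>With s = t^2 and \<open>gauss_int (2 * t)\<close> at most 2 * t, the tail 1 - H (2 t) is
  at most (1 + 4 s) exp (- 2 s). It remains that 1 + 4 s <= exp s; the quadratic Taylor bound yields
  this once s^2 / 2 >= 3 s, whence the 6.\<close>

lemma conv_cdf_ge_at_double:
  assumes "6 \<le> t\<^sup>2" "0 \<le> t"
  shows "1 - exp (- t\<^sup>2) \<le> conv_cdf (2 * t)"
proof -
  define s where "s = t\<^sup>2"
  have "1 + s + s\<^sup>2 / 2 \<le> exp s" using assms by (intro exp_lower_Taylor_quadratic) (simp add: s_def)
  moreover have "6 * s \<le> s\<^sup>2"
    using assms by (simp add: s_def power2_eq_square mult_right_mono)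
  ultimately have "1 + 4 * s \<le> exp s" by simp
  then have "(1 + 4 * s) * exp (- 2 * s) \<le> exp s * exp (- 2 * s)" by (intro mult_right_mono) auto
  then have *: "exp (- 2 * s) + 4 * s * exp (- 2 * s) \<le> exp (- s)"
    by (simp add: algebra_simps flip: exp_add)
  have "2 * t * exp (- (2 * s)) * gauss_int (2 * t) \<le> 2 * t * exp (- (2 * s)) * (2 * t)"
    using assms by (intro mult_left_mono gauss_int_le) auto
  also have "\<dots> = 4 * s * exp (- 2 * s)" by (simp add: s_def power2_eq_square)
  finally have "2 * t * exp (- (2 * s)) * gauss_int (2 * t) \<le> 4 * s * exp (- 2 * s)" .
  moreover have "exp (- (4 * s)) \<le> exp (- 2 * s)" by (simp add: s_def)
  moreover have "conv_cdf (2 * t) = 1 - exp (- (4 * s)) - 2 * t * exp (- (2 * s)) * gauss_int (2 * t)"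
    by (simp add: conv_cdf_def s_def power_mult_distrib)
  ultimately have "1 - exp (- s) \<le> conv_cdf (2 * t)" using * by linarith
  then show ?thesis by (simp add: s_def)
qed

lemma conv_cdf_eq_ex1:
  assumes "0 < P" "P < 1"
  shows "\<exists>!t. 0 < t \<and> conv_cdf t = P"
proof (rule ex_ex1I)
  \<comment> \<open>The 6 makes the doubling bound applicable; the logarithm makes 1 - exp (- s) at
    least P.\<close>
  define s where "s = max 6 (- ln (1 - P))"
  have "exp (- s) \<le> exp (ln (1 - P))" by (simp add: s_def)
  then have "P \<le> 1 - exp (- s)" using assms by simp
  also have "\<dots> \<le> conv_cdf (2 * sqrt s)"
    using conv_cdf_ge_at_double[of "sqrt s"] by (simp add: s_def)
  finally have "P \<le> conv_cdf (2 * sqrt s)" .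
  moreover have c0: "conv_cdf 0 = 0" by (simp add: conv_cdf_def)
  ultimately obtain t where t: "0 \<le> t" "conv_cdf t = P"
    using IVT'[of conv_cdf 0 P "2 * sqrt s", OF _ _ _ continuous_on_conv_cdf] assms
    by (auto simp: s_def)
  moreover have "t \<noteq> 0" using t c0 assms by auto
  ultimately show "\<exists>t. 0 < t \<and> conv_cdf t = P" by (intro exI[of _ t]) auto
next
  fix t u assume "0 < t \<and> conv_cdf t = P" "0 < u \<and> conv_cdf u = P"
  then show "t = u"
    using conv_cdf_strict_mono[of t u] conv_cdf_strict_mono[of u t]
    by (cases t u rule: linorder_cases) auto
qed

text \<open>The constants agree: sqrt (pi N) * 2 / sqrt (2 pi) = sqrt (2 N).\<close>

lemma solves_gamma_minus_iff:
  assumes "N > 0"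
  shows "solves_gamma_minus N P g \<longleftrightarrow> 0 < g \<and> conv_cdf (sqrt (2 * real N) * g) = P"
proof -
  have "sqrt (pi * real N) * g * exp (- real N * g\<^sup>2) * (2 * Phi (sqrt (2 * real N) * g) - 1)
      = sqrt (2 * real N) * g * exp (- real N * g\<^sup>2) * gauss_int (sqrt (2 * real N) * g)" if "0 < g"
    using that assms by (subst Phi_eq_gauss_int) (auto simp: real_sqrt_mult field_simps)
  then show ?thesis
    using assms unfolding solves_gamma_minus_def conv_cdf_def
    by (auto simp: zero_less_mult_iff power_mult_distrib)
qed

section \<open>Comparison of the quantiles\<close>

text \<open>Transports unique solvability along the substitutions x = exp (- 2 N e^2) and t = sqrt
  (2 N) g.\<close>

lemma ex1_bij_betw:
  assumes h: "bij_betw h A B" and ex1: "\<exists>!y. y \<in> B \<and> Q y"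
  shows "\<exists>!x. x \<in> A \<and> Q (h x)"
proof (rule ex_ex1I)
  from ex1 obtain y where "y \<in> B" "Q y" by (elim ex1E conjE)
  moreover have "B = h ` A" using h by (simp add: bij_betw_def)
  ultimately show "\<exists>x. x \<in> A \<and> Q (h x)" by blast
next
  fix x y assume *: "x \<in> A \<and> Q (h x)" "y \<in> A \<and> Q (h y)"
  then have "h x \<in> B" "h y \<in> B" using h by (simp_all add: bij_betw_apply)
  then have "h x = h y" using ex1 * by blast
  then show "x = y" using bij_betw_imp_inj_on[OF h] * by (blast dest: inj_onD)
qed

lemma bij_betw_exp_neg_square:
  assumes "0 < c"
  shows "bij_betw (\<lambda>e::real. exp (- c * e\<^sup>2)) {0<..} {0<..<1}"
proof (rule bij_betw_byWitness[where f' = "\<lambda>x. sqrt (- ln x / c)"])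
  show "\<forall>x\<in>{0<..<1}. exp (- c * (sqrt (- ln x / c))\<^sup>2) = x"
  proof
    fix x :: real assume "x \<in> {0<..<1}"
    then have "0 < x" "0 \<le> - ln x / c" using assms by (auto simp: divide_le_0_iff)
    then show "exp (- c * (sqrt (- ln x / c))\<^sup>2) = x" using assms by (simp only: real_sqrt_pow2) simp
  qed
  show "(\<lambda>x. sqrt (- ln x / c)) ` {0<..<1} \<subseteq> {0<..}"
    using assms by (auto simp: divide_less_0_iff)
qed (use assms in auto)

section \<open>Unique solvability of the three equations and comparison of their solutions\<close>

lemma solves_eps_iff:
  assumes "N > 0"
  shows "solves_eps N P e \<longleftrightarrow> 0 < e \<and> theta (exp (- (2 * real N) * e\<^sup>2)) = P"
proof -
  have "- 2 * (e * sqrt (real N))\<^sup>2 = - (2 * real N) * e\<^sup>2" by (simp add: power_mult_distrib)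
  moreover have "e * sqrt (real N) \<noteq> 0" if "0 < e" using that assms by simp
  ultimately show ?thesis unfolding solves_eps_def using kolmogorov_K_eq_theta by metis
qed

lemma solves_eps_ex1:
  assumes "N > 0" "0 < P" "P < 1"
  shows "\<exists>!e. solves_eps N P e"
proof -
  have "\<exists>!x. x \<in> {0<..<1} \<and> theta x = P"
    using theta_eq_ex1[of P] assms by (simp add: conj_assoc)
  from ex1_bij_betw[OF bij_betw_exp_neg_square[of "2 * real N"] this] assms show ?thesis
    by (simp add: solves_eps_iff)
qed

lemma solves_eps_minus_ex1:
  assumes "N > 0" "0 < P" "P < 1"
  shows "\<exists>!e. solves_eps_minus N P e"
proof -
  have "\<exists>!x. x \<in> {0<..<1} \<and> 1 - x = P"
    using assms by (intro ex1I[of _ "1 - P"]) auto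
  from ex1_bij_betw[OF bij_betw_exp_neg_square[of "2 * real N"] this] assms show ?thesis
    by (simp add: solves_eps_minus_def)
qed

lemma solves_gamma_minus_ex1:
  assumes "N > 0" "0 < P" "P < 1"
  shows "\<exists>!g. solves_gamma_minus N P g"
proof -
  let ?c = "sqrt (2 * real N)"
  have "bij_betw (\<lambda>g. ?c * g) {0<..} {0<..}"
    using assms by (intro bij_betw_byWitness[where f' = "\<lambda>t. t / ?c"]) auto
  moreover have "\<exists>!t. t \<in> {0<..} \<and> conv_cdf t = P" using conv_cdf_eq_ex1 assms by simp
  ultimately have "\<exists>!g. g \<in> {0<..} \<and> conv_cdf (?c * g) = P" by (rule ex1_bij_betw)
  then show ?thesis using assms by (simp add: solves_gamma_minus_iff)
qed

lemma eps_minus_le_eps: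
  assumes "N > 0" "0 < P" "P < 1"
  shows "eps_minus N P \<le> eps N P"
proof -
  define d where "d = eps_minus N P"
  define e where "e = eps N P"
  have d: "0 < d" "1 - exp (- (2 * real N) * d\<^sup>2) = P"
    using theI'[OF solves_eps_minus_ex1[OF assms]] by (simp_all add: d_def eps_minus_def solves_eps_minus_def)
  have e: "0 < e" "theta (exp (- (2 * real N) * e\<^sup>2)) = P"
    using theI'[OF solves_eps_ex1[OF assms]] \<open>N > 0\<close> by (simp_all add: e_def eps_def solves_eps_iff)
  \<comment> \<open>The left side is P = 1 - exp (- 2 N d^2), so the bound compares two
    exponentials, hence d and e.\<close>
  have "theta (exp (- (2 * real N) * e\<^sup>2)) \<le> 1 - exp (- (2 * real N) * e\<^sup>2)"
    using e \<open>N > 0\<close> by (intro theta_le) auto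
  with d e have "exp (- (2 * real N) * e\<^sup>2) \<le> exp (- (2 * real N) * d\<^sup>2)" by linarith
  then have "d\<^sup>2 \<le> e\<^sup>2" using \<open>N > 0\<close> by simp
  then show ?thesis using d e power2_le_imp_le[of d e] by (simp add: d_def e_def)
qed

lemma gamma_minus_le_twice_eps_minus:
  assumes "N > 0" "1 - exp (- 6) \<le> P" "P < 1"
  shows "gamma_minus N P \<le> 2 * eps_minus N P"
proof -
  have "exp (- 6 :: real) < 1" by simp
  with assms have P: "0 < P" by linarith
  define d where "d = eps_minus N P"
  define g where "g = gamma_minus N P"
  define c where "c = sqrt (2 * real N)"
  have c: "0 < c" using \<open>N > 0\<close> by (simp add: c_def)
  have "0 < d" and d: "1 - exp (- (2 * real N) * d\<^sup>2) = P"
    using theI'[OF solves_eps_minus_ex1[OF \<open>N > 0\<close> P \<open>P < 1\<close>]]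
    by (simp_all add: d_def eps_minus_def solves_eps_minus_def)
  have g: "0 < g" "conv_cdf (c * g) = P"
    using theI'[OF solves_gamma_minus_ex1[OF \<open>N > 0\<close> P \<open>P < 1\<close>]] \<open>N > 0\<close>
    by (simp_all add: g_def c_def gamma_minus_def solves_gamma_minus_iff)
  have cd: "(c * d)\<^sup>2 = 2 * real N * d\<^sup>2" by (simp add: c_def power_mult_distrib)
  \<comment> \<open>The lower bound on P becomes (c d)^2 >= 6, the range of the doubling bound;
    there P = H (c g) <= H (2 c d), and strict monotonicity gives c g <= 2 c d.\<close>
  have "exp (- (2 * real N) * d\<^sup>2) \<le> exp (- 6)" using d assms by linarith
  then have "6 \<le> (c * d)\<^sup>2" by (simp add: cd)
  then have "1 - exp (- (c * d)\<^sup>2) \<le> conv_cdf (2 * (c * d))"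
    using c \<open>0 < d\<close> by (intro conv_cdf_ge_at_double) auto
  then have "conv_cdf (c * g) \<le> conv_cdf (2 * (c * d))" using g d cd by simp
  then have "c * g \<le> c * (2 * d)"
    using conv_cdf_strict_mono[of "2 * (c * d)" "c * g"] c \<open>0 < d\<close> by (cases "2 * (c * d) < c * g") auto
  then show ?thesis using c by (simp add: d_def g_def)
qed

theorem mainTheorem3:
  shows "(\<forall>P::real. \<forall>N::nat. 0 < P \<and> P < 1 \<and> N > 0 \<longrightarrow>
            (\<exists>!e. solves_eps N P e) \<and> (\<exists>!e. solves_eps_minus N P e) \<and> (\<exists>!g. solves_gamma_minus N P g))
       \<and> (\<forall>P::real. \<forall>N::nat. 0 < P \<and> P < 1 \<and> N > 0 \<longrightarrow> eps_minus N P \<le> eps N P)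
       \<and> (\<exists>P0::real. 0 < P0 \<and> P0 < 1 \<and>
            (\<forall>P::real. \<forall>N::nat. P0 \<le> P \<and> P < 1 \<and> N > 0 \<longrightarrow>
               gamma_minus N P \<le> 2 * eps_minus N P \<and> 2 * eps_minus N P \<le> 2 * eps N P))"
proof (intro conjI allI impI)
  show "\<exists>P0::real. 0 < P0 \<and> P0 < 1 \<and>
            (\<forall>P::real. \<forall>N::nat. P0 \<le> P \<and> P < 1 \<and> N > 0 \<longrightarrow>
               gamma_minus N P \<le> 2 * eps_minus N P \<and> 2 * eps_minus N P \<le> 2 * eps N P)"
  proof (intro exI[of _ "1 - exp (- 6)"] conjI allI impI)
    fix P :: real and N :: nat
    assume *: "1 - exp (- 6) \<le> P \<and> P < 1 \<and> N > 0"
    then show "gamma_minus N P \<le> 2 * eps_minus N P"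
      by (intro gamma_minus_le_twice_eps_minus) auto
    have "exp (- 6 :: real) < 1" by simp
    then show "2 * eps_minus N P \<le> 2 * eps N P"
      using * by (intro mult_left_mono eps_minus_le_eps) linarith+
  qed auto
qed (simp_all add: solves_eps_ex1 solves_eps_minus_ex1 solves_gamma_minus_ex1 eps_minus_le_eps)

end
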